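(* Let $A=\{p_0,p_1,p_2,\dots\}$ and $B=\{q_0,q_1,q_2,\dots\}$ be two disjoint sets of positive primes. Then there are numbers $a_0,a_1,a_2,\ldots\in\mathbb N^*$ and $b_0,b_1,b_2,\ldots\in\mathbb N^*$ such that $$A\subset\bigcup_{i\in\mathbb N}\{p_i+k a_i: k\in\mathbb Z\},\qquad B\subset\bigcup_{j\in\mathbb N}\{q_j+l b_j: l\in\mathbb Z\},$$ and $$p_i+k a_i\neq q_j+l b_j$$ for any $i,j\in\mathbb N$ and any $k,l\in\mathbb Z$.
   Context: $\mathbb N$ denotes the set of natural numbers including $0$, and $\mathbb N^*$ the set of positive integers. *)

theory Defs
  imports Main "HOL-Computational_Algebra.Primes"
begin

end

theory Submission
  imports Defs
begin

text \<open>
  Take \<open>a i\<close> = \<open>p i * q 0 * \<dots> * q i\<close> and \<open>b j\<close> = \<open>q j * p 0 * \<dots> * p j\<close>.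
  If \<open>i \<le> j\<close>, then \<open>p i\<close> divides both moduli, so a common element of the
  two progressions would make \<open>p i\<close> divide the different prime \<open>q j\<close>; the case
  \<open>j \<le> i\<close> is symmetric.
\<close>

text \<open>Modulo \<open>p\<close> a common value would give \<open>p dvd q\<close>. As
  \<open>prime\<close> on \<open>int\<close> includes positivity, this forces \<open>p = q\<close>,
  not merely equality up to sign.\<close>

lemma prime_progressions_disjoint:
  fixes p q a b k l :: int
  assumes "prime p" "prime q" "p \<noteq> q" "p dvd a" "p dvd b"
  shows "p + k * a \<noteq> q + l * b"
proof
  assume "p + k * a = q + l * b"
  then have "q = p + k * a - l * b" by simp
  with assms(4,5) have "p dvd q" by simp
  with assms(1-3) show False using primes_dvd_imp_eq by blast
qed

theorem theorem4:
  fixes A B :: "int set" and p q :: "nat \<Rightarrow> int"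
  assumes "A = {p i | i. True}" and "B = {q j | j. True}"
    and "\<forall>x\<in>A. prime x" and "\<forall>x\<in>B. prime x"
    and "A \<inter> B = {}"
  shows "\<exists>a b :: nat \<Rightarrow> nat.
    (\<forall>i. a i > 0) \<and> (\<forall>j. b j > 0) \<and>
    A \<subseteq> (\<Union>i. {p i + k * int (a i) | k :: int. True}) \<and>
    B \<subseteq> (\<Union>j. {q j + l * int (b j) | l :: int. True}) \<and>
    (\<forall>i j. \<forall>k l :: int. p i + k * int (a i) \<noteq> q j + l * int (b j))"
proof -
  have p: "prime (p i)" and q: "prime (q i)" for i
    using assms(1-4) by auto
  have pos: "p i > 0" "q i > 0" for i
    using p q by (simp_all add: prime_gt_0_int)
  have ne: "p i \<noteq> q j" for i j
    using assms(1,2,5) by blast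
  \<comment> \<open>The moduli must be naturals while the primes are integers; \<open>nat\<close>
    loses nothing here because both products are positive.\<close>
  define a where "a i = nat (p i * (\<Prod>j\<le>i. q j))" for i
  define b where "b j = nat (q j * (\<Prod>i\<le>j. p i))" for j
  have a_pos: "p i * (\<Prod>j\<le>i. q j) > 0" for i
    using pos by (simp add: prod_pos)
  have b_pos: "q j * (\<Prod>i\<le>j. p i) > 0" for j
    using pos by (simp add: prod_pos)
  have a: "int (a i) = p i * (\<Prod>j\<le>i. q j)" for i
    using a_pos[of i] by (simp add: a_def)
  have b: "int (b j) = q j * (\<Prod>i\<le>j. p i)" for j
    using b_pos[of j] by (simp add: b_def)
  have disjoint: "p i + k * int (a i) \<noteq> q j + l * int (b j)" for i j k l
  proof (cases "i \<le> j")
    case True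
    \<comment> \<open>Since \<open>i \<le> j\<close>, \<open>p i\<close> is one of the factors of
      the product in \<open>b j\<close>.\<close>
    then have "p i dvd int (b j)" unfolding b by (intro dvd_mult dvd_prodI) auto
    moreover have "p i dvd int (a i)" unfolding a by simp
    ultimately show ?thesis by (intro prime_progressions_disjoint p q ne)
  next
    case False
    then have "q j dvd int (a i)" unfolding a by (intro dvd_mult dvd_prodI) auto
    moreover have "q j dvd int (b j)" unfolding b by simp
    \<comment> \<open>Now \<open>q j\<close> is the common divisor, so the lemma is used with the
      two progressions exchanged.\<close>
    ultimately show ?thesis
      by (intro prime_progressions_disjoint[symmetric] p q ne[symmetric])
  qed
  \<comment> \<open>Each prime is the term with coefficient 0 of its own progression.\<close>
  have "p i \<in> {p i + k * int (a i) | k :: int. True}"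
    and "q i \<in> {q i + l * int (b i) | l :: int. True}" for i
    by (auto intro: exI[of _ 0])
  then have "A \<subseteq> (\<Union>i. {p i + k * int (a i) | k :: int. True})"
    and "B \<subseteq> (\<Union>j. {q j + l * int (b j) | l :: int. True})"
    unfolding assms(1,2) by fast+
  moreover have "a i > 0" "b i > 0" for i
    using a_pos b_pos by (simp_all add: a_def b_def)
  ultimately show ?thesis using disjoint by (intro exI[of _ a] exI[of _ b]) simp
qed

end
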